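(* Let $(p_k)_{k\ge 0}$ be defined by $p_0=1$, $p_1=1$ and $p_{k+1}=2p_k+p_{k-1}$ for $k\ge 1$ (so that, for $k\ge1$, $p_k$ is the numerator of the $k$-th convergent of $\sqrt{2}$). Then for all integers $k\ge 1$ and $n\ge 1$, $$\sqrt{(p_{k+1}n+1)^2+(2p_k n+1)}=\left[p_{k+1}n+1;\ \overline{\underbrace{2,\dots,2}_{k\text{ times}},\,1,\,p_{k+1}n,\,1,\,\underbrace{2,\dots,2}_{k\text{ times}},\,2(p_{k+1}n+1)}\right].$$
   Context: $[a_0;\overline{a_1,\dots,a_\ell}]$ denotes the value of the infinite simple continued fraction $a_0+\cfrac{1}{a_1+\cfrac{1}{a_2+\dotsb}}$ with first partial quotient $a_0$, after which the block $a_1,\dots,a_\ell$ of positive integers is repeated indefinitely. The convergents of $\sqrt2=[1;\overline{2}]$ are indexed starting from $1$: the first is $1/1$, the second $3/2$, the third $7/5$, the fourth $17/12$, etc. *)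

theory Defs
  imports Complex_Main
begin

primrec cfrac_conv :: "nat \<Rightarrow> (nat \<Rightarrow> int) \<Rightarrow> real" where
  "cfrac_conv 0 a = of_int (a 0)"
| "cfrac_conv (Suc m) a = of_int (a 0) + 1 / cfrac_conv m (\<lambda>i. a (Suc i))"

text \<open>
  The infinite continued fraction with partial quotients \<open>a 0, a 1, \<dots>\<close> is simple
  (\<open>a i\<close> is positive for every \<open>i \<ge> 1\<close>), converges, and has value \<open>x\<close>.
\<close>

definition has_simple_cfrac :: "real \<Rightarrow> (nat \<Rightarrow> int) \<Rightarrow> bool" where
  "has_simple_cfrac x a \<longleftrightarrow>
     (\<forall>i\<ge>1. a i > 0) \<and> (\<lambda>m. cfrac_conv m a) \<longlonglongrightarrow> x"

definition periodic_quotients :: "int \<Rightarrow> int list \<Rightarrow> nat \<Rightarrow> int" where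
  "periodic_quotients a\<^sub>0 block i =
     (case i of 0 \<Rightarrow> a\<^sub>0 | Suc j \<Rightarrow> block ! (j mod length block))"

fun sqrt2_num :: "nat \<Rightarrow> nat" where
  "sqrt2_num 0 = 1"
| "sqrt2_num (Suc 0) = 1"
| "sqrt2_num (Suc (Suc k)) = 2 * sqrt2_num (Suc k) + sqrt2_num k"

end

theory Submission
  imports Defs
begin

text \<open>
  Write \<open>P = p\<^sub>k\<^sub>+\<^sub>1\<close>, \<open>p = p\<^sub>k\<close>, \<open>a = P n + 1\<close>, \<open>c = 2 p n + 1\<close> and \<open>s = \<surd>(a\<^sup>2 + c)\<close>. The only
  candidate for the value of the periodic part is \<open>t = 1 / (s - a)\<close>, which equals \<open>y / c\<close> for
  \<open>y = s + a\<close>, because \<open>c = s\<^sup>2 - a\<^sup>2\<close>. Two things have to be seen.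

  First, a finite block of positive quotients that reproduces \<open>t\<close> when it is put in front of \<open>t\<close>
  already forces the periodic continued fraction to converge to \<open>a + 1 / t = s\<close>
  (\<open>has_simple_cfrac_periodic\<close>). The complete quotients of this expansion are at least \<open>1\<close>, and
  the product of two consecutive ones is at least \<open>2\<close>; the same holds for the finite continued
  fractions, so two steps of the recursion shrink the error at least by a factor of \<open>4\<close>
  (\<open>cfrac_conv_error\<close>).

  Second, the given block does reproduce \<open>t\<close> (\<open>sqrt2_block_fixed_point\<close>). A run of \<open>k\<close> twos is a
  Moebius map with symmetric matrix \<open>(\<alpha>, \<beta>; \<beta>, \<gamma>)\<close>, the \<open>k\<close>-th power of \<open>(2, 1; 1, 0)\<close>, where
  \<open>\<alpha> + \<beta> = P\<close> and \<open>\<alpha> - \<beta> = \<beta> + \<gamma> = p\<close>; hence its entries are linear in \<open>P\<close> and \<open>p\<close>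
  (\<open>cfrac_onto_replicate_two\<close>). The block without its last entry is a palindrome, so it has a
  symmetric matrix \<open>(A, B; B, C)\<close> too. The last entry \<open>2 a\<close> turns \<open>t\<close> into \<open>2 a + 1 / t = y\<close>, and
  what is left to prove is \<open>y / c = (A y + B) / (B y + C)\<close>. Since \<open>y\<^sup>2 = 2 a y + c\<close>, this
  amounts to \<open>c A = C + 2 a B\<close>, a polynomial identity once \<open>a\<close> and \<open>c\<close> are expressed by \<open>P\<close>, \<open>p\<close>
  and \<open>n\<close>.
\<close>

section \<open>Convergence from complete quotients\<close>

lemma cfrac_conv_ge_1:
  assumes "\<And>i. a i \<ge> 1"
  shows "cfrac_conv m a \<ge> 1"
  using assms
proof (induction m arbitrary: a)
  case 0
  then show ?case by simp
next
  case (Suc m)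
  have "cfrac_conv m (\<lambda>i. a (Suc i)) \<ge> 1"
    by (rule Suc.IH) (rule Suc.prems)
  moreover have "real_of_int (a 0) \<ge> 1"
    using Suc.prems[of 0] by simp
  ultimately show ?case by (simp add: add_increasing2)
qed

text \<open>
  One step of the recursion gives \<open>1 / x - 1 / z = (z - x) / (x z)\<close>, which need not shrink the
  error, as \<open>x z\<close> may be close to \<open>1\<close>. Over two steps the denominators multiply to
  \<open>(x\<^sub>1 x\<^sub>2) (z\<^sub>1 z\<^sub>2)\<close>, and each bracket has the form \<open>a\<^sub>1 w + 1\<close> with \<open>w \<ge> 1\<close>, so it is at least
  \<open>2\<close>. The factor \<open>2\<close> in front of the geometric term lets the induction start at both \<open>0\<close> and \<open>1\<close>.
\<close>

lemma cfrac_conv_error: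
  fixes x :: "nat \<Rightarrow> real"
  assumes "\<And>i. x i = a i + 1 / x (Suc i)"
    and "\<And>i. i \<ge> 1 \<Longrightarrow> a i \<ge> 1" and "\<And>i. i \<ge> 1 \<Longrightarrow> x i \<ge> 1"
  shows "\<bar>x 0 - cfrac_conv m a\<bar> \<le> 2 * (1 / 2) ^ m"
  using assms
proof (induction m arbitrary: x a rule: less_induct)
  case (less m)
  have x1: "x 1 \<ge> 1" and x2: "x 2 \<ge> 1" and a1: "real_of_int (a 1) \<ge> 1"
    using less.prems(2)[of 1] less.prems(3) by auto
  have x0_eq: "x 0 = a 0 + 1 / x 1" and x1_eq: "x 1 = a 1 + 1 / x 2"
    using less.prems(1)[of 0] less.prems(1)[of 1] by (auto simp: numeral_2_eq_2)
  consider "m = 0" | "m = 1" | l where "m = Suc (Suc l)"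
    by (metis One_nat_def not0_implies_Suc)
  then show ?case
  proof cases
    case 1
    have "1 / x 1 \<le> 1" "1 / x 1 \<ge> 0"
      using x1 by auto
    then show ?thesis
      using 1 x0_eq by simp
  next
    case 2
    have "1 / x 1 \<le> 1" "1 / x 1 \<ge> 0" "1 / real_of_int (a 1) \<le> 1" "1 / real_of_int (a 1) \<ge> 0"
      using x1 a1 by auto
    then have "\<bar>1 / x 1 - 1 / a 1\<bar> \<le> 1"
      by linarith
    then show ?thesis
      using 2 x0_eq by simp
  next
    case 3
    define z1 where "z1 = cfrac_conv (Suc l) (\<lambda>i. a (Suc i))"
    define z2 where "z2 = cfrac_conv l (\<lambda>i. a (Suc (Suc i)))"
    have z2: "z2 \<ge> 1"
      unfolding z2_def by (rule cfrac_conv_ge_1) (simp add: less.prems(2))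
    have z1_eq: "z1 = a 1 + 1 / z2"
      by (simp add: z1_def z2_def)
    have z1: "z1 \<ge> 1"
      using z1_eq a1 z2 by (simp add: add_increasing2)
    have "\<bar>x (Suc (Suc 0)) - z2\<bar> \<le> 2 * (1 / 2) ^ l"
      unfolding z2_def
    proof (rule less.IH[of l "\<lambda>i. x (Suc (Suc i))" "\<lambda>i. a (Suc (Suc i))"])
      show "l < m"
        using 3 by simp
      show "x (Suc (Suc i)) = a (Suc (Suc i)) + 1 / x (Suc (Suc (Suc i)))" for i
        by (rule less.prems(1))
      show "a (Suc (Suc i)) \<ge> 1" for i
        by (rule less.prems(2)) simp
      show "x (Suc (Suc i)) \<ge> 1" for i
        by (rule less.prems(3)) simp
    qed
    then have IH: "\<bar>x 2 - z2\<bar> \<le> 2 * (1 / 2) ^ l"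
      by (simp add: numeral_2_eq_2)
    have "x 1 * x 2 = a 1 * x 2 + 1" "z1 * z2 = a 1 * z2 + 1"
      using x1_eq z1_eq x2 z2 by (simp_all add: field_simps)
    moreover have "a 1 * x 2 \<ge> 1" "a 1 * z2 \<ge> 1"
      using mult_mono[OF a1 x2] mult_mono[OF a1 z2] a1 by auto
    ultimately have two_le: "x 1 * x 2 \<ge> 2" "z1 * z2 \<ge> 2"
      by linarith+
    then have four_le: "(x 1 * x 2) * (z1 * z2) \<ge> 4"
      using mult_mono[OF two_le] by simp
    have step1: "z1 - x 1 = (x 2 - z2) / (x 2 * z2)"
      unfolding x1_eq z1_eq using x2 z2 by (simp add: field_simps)
    have conv_eq: "cfrac_conv m a = a 0 + 1 / z1"
      using 3 by (simp add: z1_def)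
    have "x 0 - cfrac_conv m a = (z1 - x 1) / (x 1 * z1)"
      unfolding x0_eq conv_eq using x1 z1 by (simp add: field_simps)
    also have "\<dots> = (x 2 - z2) / ((x 1 * x 2) * (z1 * z2))"
      unfolding step1 by (simp add: ac_simps)
    finally have "x 0 - cfrac_conv m a = (x 2 - z2) / ((x 1 * x 2) * (z1 * z2))" .
    then have "\<bar>x 0 - cfrac_conv m a\<bar> = \<bar>x 2 - z2\<bar> / ((x 1 * x 2) * (z1 * z2))"
      using four_le by (simp only: abs_divide)
    also have "\<dots> \<le> \<bar>x 2 - z2\<bar> / 4"
      using four_le by (intro divide_left_mono) auto
    also have "\<dots> \<le> 2 * (1 / 2) ^ m"
      using IH 3 by simp
    finally show ?thesis .
  qed
qed

lemma has_simple_cfrac_complete_quotients: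
  fixes x :: "nat \<Rightarrow> real"
  assumes "\<And>i. x i = a i + 1 / x (Suc i)"
    and "\<And>i. i \<ge> 1 \<Longrightarrow> a i \<ge> 1" and "\<And>i. i \<ge> 1 \<Longrightarrow> x i \<ge> 1"
  shows "has_simple_cfrac (x 0) a"
proof -
  have "(\<lambda>m. 2 * (1 / 2 :: real) ^ m) \<longlonglongrightarrow> 0"
    by (intro tendsto_mult_right_zero LIMSEQ_power_zero) simp
  moreover have "\<forall>\<^sub>F m in sequentially.
      norm (cfrac_conv m a - x 0) \<le> norm (2 * (1 / 2 :: real) ^ m) * 1"
    using cfrac_conv_error[of x a, OF assms] by (simp add: abs_minus_commute)
  ultimately have "(\<lambda>m. cfrac_conv m a - x 0) \<longlonglongrightarrow> 0"
    by (rule tendsto_0_le)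
  then have "(\<lambda>m. cfrac_conv m a) \<longlonglongrightarrow> x 0"
    using LIM_zero_iff by blast
  moreover have "a i > 0" if "i \<ge> 1" for i
    using assms(2)[OF that] by simp
  ultimately show ?thesis
    by (simp add: has_simple_cfrac_def)
qed

section \<open>Periodic continued fractions\<close>

definition cfrac_onto :: "int list \<Rightarrow> real \<Rightarrow> real" where
  "cfrac_onto bs t = foldr (\<lambda>b z. of_int b + 1 / z) bs t"

lemma cfrac_onto_simps [simp]:
  "cfrac_onto [] t = t"
  "cfrac_onto (b # bs) t = b + 1 / cfrac_onto bs t"
  "cfrac_onto (bs @ cs) t = cfrac_onto bs (cfrac_onto cs t)"
  by (simp_all add: cfrac_onto_def)

lemma cfrac_onto_pos:
  assumes "\<And>b. b \<in> set bs \<Longrightarrow> b \<ge> 1" and "t > 0"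
  shows "cfrac_onto bs t > 0"
  using assms
proof (induction bs)
  case (Cons b bs)
  then have "cfrac_onto bs t > 0" "real_of_int b \<ge> 1" by auto
  then show ?case by (simp add: add_pos_pos)
qed simp

lemma cfrac_onto_ge_1:
  assumes "\<And>b. b \<in> set bs \<Longrightarrow> b \<ge> 1" and "t > 0" and "bs \<noteq> []"
  shows "cfrac_onto bs t \<ge> 1"
proof -
  obtain b cs where bs: "bs = b # cs"
    using assms(3) by (cases bs) auto
  then have "cfrac_onto cs t > 0" "real_of_int b \<ge> 1"
    using assms by (auto intro: cfrac_onto_pos)
  then show ?thesis
    using bs by (simp add: add_increasing2)
qed

text \<open>
  The complete quotient reached inside a period is the remaining part of the block put in front
  of \<open>t\<close>; the fixed point equation is what makes these quotients match up where one period ends and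
  the next begins.
\<close>

lemma has_simple_cfrac_periodic:
  assumes fixed: "cfrac_onto bs t = t" and "t > 0"
    and bs: "\<And>b. b \<in> set bs \<Longrightarrow> b \<ge> 1" and ne: "bs \<noteq> []"
  shows "has_simple_cfrac (of_int a0 + 1 / t) (periodic_quotients a0 bs)"
proof -
  define L where "L = length bs"
  define x where
    "x i = (case i of 0 \<Rightarrow> of_int a0 + 1 / t | Suc j \<Rightarrow> cfrac_onto (drop (j mod L) bs) t)" for i
  have L: "L > 0" and mod_L: "j mod L < L" for j
    using ne by (simp_all add: L_def)
  have step: "x i = periodic_quotients a0 bs i + 1 / x (Suc i)" for i
  proof (cases i)
    case 0
    then show ?thesis
      using fixed by (simp add: x_def periodic_quotients_def)
  next
    case (Suc j)
    have "cfrac_onto (drop (Suc (j mod L)) bs) t = cfrac_onto (drop (Suc j mod L) bs) t"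
    proof (cases "Suc (j mod L) = L")
      case True
      then have "Suc j mod L = 0"
        by (simp add: mod_Suc)
      then show ?thesis
        using True fixed by (simp add: L_def)
    next
      case False
      then show ?thesis
        by (simp add: mod_Suc)
    qed
    moreover have "drop (j mod L) bs = bs ! (j mod L) # drop (Suc (j mod L)) bs"
      using mod_L[of j] by (simp add: Cons_nth_drop_Suc L_def)
    ultimately show ?thesis
      using Suc by (simp add: x_def periodic_quotients_def L_def)
  qed
  have "has_simple_cfrac (x 0) (periodic_quotients a0 bs)"
  proof (rule has_simple_cfrac_complete_quotients)
    show "x i = periodic_quotients a0 bs i + 1 / x (Suc i)" for i
      by (rule step)
  next
    fix i :: nat
    assume "i \<ge> 1"
    then obtain j where i: "i = Suc j"
      by (cases i) auto
    show "periodic_quotients a0 bs i \<ge> 1"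
      using bs mod_L[of j] by (simp add: i periodic_quotients_def L_def)
    show "x i \<ge> 1"
      using cfrac_onto_ge_1[of "drop (j mod L) bs" t] bs \<open>t > 0\<close> mod_L[of j]
        in_set_dropD[of _ "j mod L" bs]
      by (force simp: i x_def L_def)
  qed
  then show ?thesis
    by (simp add: x_def)
qed

section \<open>Runs of twos and the numerators of the convergents of the square root of two\<close>

lemma sqrt2_num_pos: "sqrt2_num k > 0"
  by (induction k rule: sqrt2_num.induct) auto

lemma sqrt2_num_le_Suc: "sqrt2_num k \<le> sqrt2_num (Suc k)"
  by (cases k) auto

lemma sqrt2_num_Suc_le: "sqrt2_num (Suc k) \<le> 3 * sqrt2_num k"
  using sqrt2_num_le_Suc[of "k - 1"] by (cases k) auto

text \<open>
  Numerator and denominator are twice those given by the matrix \<open>(2, 1; 1, 0)\<^sup>k\<close>; the doubling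
  makes every coefficient an integral combination of two consecutive numerators, so that the
  denominators of the convergents do not enter.
\<close>

lemma cfrac_onto_replicate_two:
  fixes k :: nat and z :: real
  defines "P \<equiv> real (sqrt2_num (Suc k))" and "p \<equiv> real (sqrt2_num k)"
  assumes "z \<ge> 1"
  shows "cfrac_onto (replicate k 2) z = ((P + p) * z + (P - p)) / ((P - p) * z + (3 * p - P))"
  unfolding P_def p_def
proof (induction k)
  case 0
  then show ?case by simp
next
  case (Suc k)
  define P p where "P = real (sqrt2_num (Suc k))" and "p = real (sqrt2_num k)"
  have p: "p > 0" and P: "P \<ge> p"
    using sqrt2_num_pos[of k] sqrt2_num_le_Suc[of k] by (simp_all add: P_def p_def)
  \<comment> \<open>With \<open>z\<close> replaced by \<open>1\<close> the denominator becomes \<open>2 p\<close>.\<close>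
  have "(P - p) * z \<ge> (P - p) * 1"
    using P \<open>z \<ge> 1\<close> by (intro mult_left_mono) auto
  then have den: "(P - p) * z + (3 * p - P) > 0"
    using p by simp
  have num: "(P + p) * z + (P - p) > 0"
    using p P \<open>z \<ge> 1\<close> by (intro add_pos_nonneg) auto
  have P': "real (sqrt2_num (Suc (Suc k))) = 2 * P + p"
    by (simp add: P_def p_def)
  have "cfrac_onto (replicate (Suc k) 2) z
      = 2 + ((P - p) * z + (3 * p - P)) / ((P + p) * z + (P - p))"
    using Suc.IH by (simp add: P_def p_def)
  also have "\<dots> = ((2 * P + p + P) * z + (2 * P + p - P))
      / ((2 * P + p - P) * z + (3 * P - (2 * P + p)))"
    using num by (simp add: add_divide_eq_iff) (simp add: algebra_simps)
  finally show ?case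
    unfolding P' P_def[symmetric] by simp
qed

section \<open>The square root as the value of the periodic continued fraction\<close>

text \<open>
  In terms of \<open>z\<close>, the value after the second run of twos, the middle quotients contribute
  \<open>((a + 1) z + a) / (a z + a - 1)\<close>. Composing with the two runs gives a quotient of linear forms in
  \<open>y\<close>, and clearing denominators leaves a multiple of \<open>y\<^sup>2 - 2 a y - c = 0\<close>.
\<close>

lemma sqrt2_block_fixed_point:
  fixes k n :: nat and y :: real
  defines "P \<equiv> real (sqrt2_num (Suc k))" and "p \<equiv> real (sqrt2_num k)"
  defines "a \<equiv> P * real n + 1" and "c \<equiv> 2 * p * real n + 1"
  assumes y: "y\<^sup>2 = 2 * a * y + c" and "y \<ge> 1" and "n \<ge> 1"
  shows "cfrac_onto (replicate k 2 @ [1, int (sqrt2_num (Suc k)) * int n, 1] @ replicate k 2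
      @ [2 * (int (sqrt2_num (Suc k)) * int n + 1)]) (y / c) = y / c"
proof -
  have p: "p > 0" and P: "P \<ge> p" and P3: "P \<le> 3 * p"
    using sqrt2_num_pos[of k] sqrt2_num_le_Suc[of k] sqrt2_num_Suc_le[of k]
    by (simp_all add: P_def p_def)
  have c: "c > 0"
    using p by (simp add: c_def add_nonneg_pos)
  have a: "a > 1"
    using p P \<open>n \<ge> 1\<close> by (simp add: a_def)
  have last_quotient: "2 * a + 1 / (y / c) = y"
    using y \<open>y \<ge> 1\<close> by (simp add: field_simps power2_eq_square)
  define X Y where "X = (P + p) * y + (P - p)" and "Y = (P - p) * y + (3 * p - P)"
  define z where "z = X / Y"
  have XY: "X > 0" "Y > 0"
  proof -
    show "X > 0"
      unfolding X_def using p P \<open>y \<ge> 1\<close> by (intro add_pos_nonneg) auto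
    have "(P - p) * y \<ge> (P - p) * 1"
      using P \<open>y \<ge> 1\<close> by (intro mult_left_mono) auto
    then show "Y > 0"
      unfolding Y_def using p by simp
  qed
  have z_eq: "cfrac_onto (replicate k 2) y = z"
    using cfrac_onto_replicate_two[OF \<open>y \<ge> 1\<close>, of k] by (simp add: z_def X_def Y_def P_def p_def)
  define V W where "V = (a + 1) * X + a * Y" and "W = a * X + (a - 1) * Y"
  have W: "W > 0"
    unfolding W_def using XY a by (intro add_pos_pos) auto
  have V: "V = W + X + Y"
    by (simp add: V_def W_def algebra_simps)
  define u where "u = V / W"
  have u_ge: "u \<ge> 1"
    using V W XY by (simp add: u_def)
  have "1 + 1 / z = (X + Y) / X"
    using XY by (simp add: z_def field_simps)
  then have "(a - 1) + 1 / (1 + 1 / z) = (a - 1) + X / (X + Y)"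
    by simp
  also have "\<dots> = W / (X + Y)"
    using XY by (simp add: W_def field_simps)
  finally have "(a - 1) + 1 / (1 + 1 / z) = W / (X + Y)" .
  then have u_eq: "1 + 1 / ((a - 1) + 1 / (1 + 1 / z)) = u"
    using XY W by (simp add: u_def V add_divide_distrib)
  have "cfrac_onto (replicate k 2 @ [1, int (sqrt2_num (Suc k)) * int n, 1] @ replicate k 2
      @ [2 * (int (sqrt2_num (Suc k)) * int n + 1)]) (y / c) = cfrac_onto (replicate k 2) u"
    using last_quotient z_eq u_eq by (simp add: a_def P_def)
  also have "\<dots> = ((P + p) * u + (P - p)) / ((P - p) * u + (3 * p - P))"
    using cfrac_onto_replicate_two[OF u_ge, of k] by (simp add: P_def p_def)
  also have "\<dots> = ((P + p) * V + (P - p) * W) / ((P - p) * V + (3 * p - P) * W)"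
    using W by (simp add: u_def divide_simps)
  also have "\<dots> = y / c"
  proof -
    have "(P - p) * V \<ge> (P - p) * W"
      using P V XY by (intro mult_left_mono) auto
    moreover have "p * W > 0"
      using p W by simp
    ultimately have "(P - p) * V + (3 * p - P) * W > 0"
      by (simp add: algebra_simps)
    moreover have "((P + p) * V + (P - p) * W) * c = y * ((P - p) * V + (3 * p - P) * W)"
    proof -
      \<comment> \<open>The symmetric matrix of the palindrome; the factor \<open>4\<close> comes from the two doubled runs.\<close>
      define A B C where "A = P * (a * P + p)" and "B = a * P * p + (P - p)\<^sup>2 / 2"
        and "C = p * (a * p + P - 2 * p)"
      have num: "(P + p) * V + (P - p) * W = 4 * (A * y + B)"
        unfolding V_def W_def X_def Y_def A_def B_def
        by (simp add: algebra_simps power2_eq_square add_divide_distrib diff_divide_distrib)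
      have den: "(P - p) * V + (3 * p - P) * W = 4 * (B * y + C)"
        unfolding V_def W_def X_def Y_def B_def C_def
        by (simp add: algebra_simps power2_eq_square add_divide_distrib diff_divide_distrib)
      have key: "A * c = C + 2 * a * B"
        unfolding A_def B_def C_def a_def c_def
        by (simp add: algebra_simps power2_eq_square add_divide_distrib diff_divide_distrib)
      have "(A * y + B) * c = (A * c) * y + B * c"
        by (simp add: algebra_simps)
      also have "\<dots> = B * (2 * a * y + c) + C * y"
        unfolding key by (simp add: algebra_simps)
      also have "\<dots> = y * (B * y + C)"
        unfolding y[symmetric] by (simp add: algebra_simps power2_eq_square)
      finally show ?thesis
        unfolding num den by (simp del: distrib_left_numeral)
    qed
    ultimately show ?thesis
      using c by (simp add: frac_eq_eq)
  qed
  finally show ?thesis .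
qed

theorem theorem1:
  fixes k n :: nat
  assumes "k \<ge> 1" and "n \<ge> 1"
  shows "has_simple_cfrac
     (sqrt ((real (sqrt2_num (k + 1)) * real n + 1)\<^sup>2 + (2 * real (sqrt2_num k) * real n + 1)))
     (periodic_quotients (int (sqrt2_num (k + 1)) * int n + 1)
        (replicate k 2 @ [1, int (sqrt2_num (k + 1)) * int n, 1] @ replicate k 2
           @ [2 * (int (sqrt2_num (k + 1)) * int n + 1)]))"
proof -
  define a where "a = real (sqrt2_num (Suc k)) * real n + 1"
  define c where "c = 2 * real (sqrt2_num k) * real n + 1"
  define s where "s = sqrt (a\<^sup>2 + c)"
  have a: "a \<ge> 1" and c: "c > 0"
    by (simp_all add: a_def c_def add_nonneg_pos)
  have s_sq: "s\<^sup>2 = a\<^sup>2 + c"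
    using c by (simp add: s_def)
  have s: "s \<ge> 0"
    using c by (simp add: s_def)
  have "(s + a)\<^sup>2 = 2 * a * (s + a) + c"
    using s_sq by (simp add: power2_eq_square algebra_simps)
  then have fixed: "cfrac_onto (replicate k 2 @ [1, int (sqrt2_num (Suc k)) * int n, 1]
      @ replicate k 2 @ [2 * (int (sqrt2_num (Suc k)) * int n + 1)]) ((s + a) / c) = (s + a) / c"
    unfolding a_def c_def using a s \<open>n \<ge> 1\<close>
    by (intro sqrt2_block_fixed_point) (simp_all add: a_def)
  have "int (sqrt2_num (Suc k)) * int n \<ge> 1"
    using sqrt2_num_pos[of "Suc k"] \<open>n \<ge> 1\<close> by (simp add: Suc_le_eq flip: of_nat_mult)
  then have "has_simple_cfrac
      (of_int (int (sqrt2_num (Suc k)) * int n + 1) + 1 / ((s + a) / c))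
      (periodic_quotients (int (sqrt2_num (Suc k)) * int n + 1)
        (replicate k 2 @ [1, int (sqrt2_num (Suc k)) * int n, 1] @ replicate k 2
           @ [2 * (int (sqrt2_num (Suc k)) * int n + 1)]))"
    using a s c by (intro has_simple_cfrac_periodic fixed) auto
  moreover have "a + 1 / ((s + a) / c) = s"
    using a s s_sq by (simp add: field_simps power2_eq_square)
  ultimately show ?thesis
    by (simp add: s_def a_def c_def)
qed

end
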